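(* With any system fulfilling $T_S=p_w(T_1,\ldots,T_n)$ for some weighted lattice polynomial function $p_w:L^n\to L$ is associated a unique family of nondecreasing and nonconstant structure functions $\{\phi_{v_t}:\ t\geqslant 0\}$, where $v_t(A)=\mathrm{Ind}(w(A)>t)$ for all $A\subseteq[n]$, such that $$X_S(t)=\phi_{v_t}(\mathbf X(t))\qquad(t\geqslant 0).$$
   Context: Write $[n]=\{1,\ldots,n\}$ and $L=[0,\infty]$, with lattice operations $\wedge=\min$ and $\vee=\max$. For an event $E$, $\mathrm{Ind}(E)$ is the indicator random variable equal to $1$ if $E$ occurs and $0$ otherwise. Consider a system of $n$ components. $T_i$ denotes the random time-to-failure (lifetime) of component $i\in[n]$ and $T_S$ that of the system, all with values in $[0,\infty]$. For $t\geqslant 0$, $X_i(t)=\mathrm{Ind}(T_i>t)$ is the random state of component $i$ at time $t$, $\mathbf X(t)=(X_1(t),\ldots,X_n(t))$, and $X_S(t)=\mathrm{Ind}(T_S>t)$ is the random state of the system at time $t$. A structure function is a Boolean function $\phi:\{0,1\}^n\to\{0,1\}$ that expresses the state of a system ($1$ if functioning, $0$ if failed) in terms of the states of its components. For a set function $v:2^{[n]}\to\{0,1\}$, $\phi_v:\{0,1\}^n\to\{0,1\}$ is the function $$\phi_v(\mathbf x)=\sum_{A\subseteq[n]}v(A)\prod_{i\in A}x_i\prod_{i\in[n]\setminus A}(1-x_i),$$ so that $v(A)$ is the value of $\phi_v$ at the characteristic vector of $A$ in $\{0,1\}^n$. The weighted lattice polynomial functions from $L^n$ to $L$ are the functions obtained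 from the projections $\mathbf t\mapsto t_k$ ($k\in[n]$) and the constant functions $\mathbf t\mapsto c$ ($c\in L$) by finitely many applications of $\wedge$ and $\vee$ (taken pointwise). Each such function can be written as $$p_w(\mathbf t)=\bigvee_{A\subseteq[n]}\Bigl(w(A)\wedge\bigwedge_{i\in A}t_i\Bigr)$$ for exactly one set function $w:2^{[n]}\to L$ that is nondecreasing with respect to inclusion (the empty minimum being $\infty$); $p_w$ denotes the weighted lattice polynomial function defined in this way by the nondecreasing set function $w$.
   Formalization: "Nonconstant" fails in general (w = 0 gives φ_{v_t} = 0), so it is replaced by: φ_{v_t} is nonconstant iff w(∅) ≤ t < w([n]); uniqueness is among families with X_S(t) = φ(X(t)) for all lifetimes satisfying T_S = p_w(T), since it fails for one fixed choice of lifetimes. *)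

theory Defs
  imports "HOL-Probability.Probability"
begin

text \<open>
  The index set of components is a finite type \<open>'n\<close>, and the lattice \<open>[0, \<infinity>]\<close> is \<^typ>\<open>ennreal\<close>,
  so that \<^term>\<open>inf\<close> and \<^term>\<open>sup\<close> are min and max.
\<close>

inductive_set weighted_lattice_polynomials :: "(('n::finite \<Rightarrow> ennreal) \<Rightarrow> ennreal) set" where
  proj: "(\<lambda>t. t k) \<in> weighted_lattice_polynomials"
| const: "(\<lambda>t. c) \<in> weighted_lattice_polynomials"
| meet: "p \<in> weighted_lattice_polynomials \<Longrightarrow> q \<in> weighted_lattice_polynomials \<Longrightarrow>
    (\<lambda>t. inf (p t) (q t)) \<in> weighted_lattice_polynomials"
| join: "p \<in> weighted_lattice_polynomials \<Longrightarrow> q \<in> weighted_lattice_polynomials \<Longrightarrow>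
    (\<lambda>t. sup (p t) (q t)) \<in> weighted_lattice_polynomials"

text \<open>In \<^typ>\<open>ennreal\<close> the infimum over the empty set is \<open>\<infinity>\<close>, as required for \<open>A = {}\<close>.\<close>

definition wlp :: "('n::finite set \<Rightarrow> ennreal) \<Rightarrow> ('n \<Rightarrow> ennreal) \<Rightarrow> ennreal" where
  "wlp w t = (SUP A. inf (w A) (INF i\<in>A. t i))"

definition boolean_vectors :: "('n::finite \<Rightarrow> real) set" where
  "boolean_vectors = UNIV \<rightarrow> {0, 1}"

text \<open>
  Functions \<open>{0,1}^n \<rightarrow> {0,1}\<close> are taken extensional (\<open>undefined\<close> off \<^const>\<open>boolean_vectors\<close>), so that
  HOL equality of structure functions is equality on \<open>{0,1}^n\<close>.
\<close>

definition structure_functions :: "(('n::finite \<Rightarrow> real) \<Rightarrow> real) set" where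
  "structure_functions = boolean_vectors \<rightarrow>\<^sub>E {0, 1}"

definition phi :: "('n::finite set \<Rightarrow> real) \<Rightarrow> ('n \<Rightarrow> real) \<Rightarrow> real" where
  "phi v = (\<lambda>x\<in>boolean_vectors. \<Sum>A\<in>UNIV. v A * (\<Prod>i\<in>A. x i) * (\<Prod>i\<in>UNIV - A. 1 - x i))"

definition level :: "('n::finite set \<Rightarrow> ennreal) \<Rightarrow> real \<Rightarrow> 'n set \<Rightarrow> real" where
  "level w t A = of_bool (w A > ennreal t)"

definition state :: "('a \<Rightarrow> ennreal) \<Rightarrow> real \<Rightarrow> 'a \<Rightarrow> real" where
  "state T t \<omega> = of_bool (T \<omega> > ennreal t)"

text \<open>Equality of random variables is read pointwise on the sample space, here and below.\<close>

definition lifetime_system ::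
  "'a measure \<Rightarrow> (('n::finite \<Rightarrow> ennreal) \<Rightarrow> ennreal) \<Rightarrow> ('n \<Rightarrow> 'a \<Rightarrow> ennreal) \<Rightarrow> ('a \<Rightarrow> ennreal) \<Rightarrow> bool" where
  "lifetime_system M p T T\<^sub>S \<longleftrightarrow>
     (\<forall>i. T i \<in> borel_measurable M) \<and> T\<^sub>S \<in> borel_measurable M \<and>
     (\<forall>\<omega>\<in>space M. T\<^sub>S \<omega> = p (\<lambda>i. T i \<omega>))"

definition expresses_state ::
  "'a measure \<Rightarrow> ('n::finite \<Rightarrow> 'a \<Rightarrow> ennreal) \<Rightarrow> ('a \<Rightarrow> ennreal) \<Rightarrow> (real \<Rightarrow> ('n \<Rightarrow> real) \<Rightarrow> real) \<Rightarrow> bool" where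
  "expresses_state M T T\<^sub>S \<psi> \<longleftrightarrow>
     (\<forall>t\<ge>0. \<forall>\<omega>\<in>space M. state T\<^sub>S t \<omega> = \<psi> t (\<lambda>i. state (T i) t \<omega>))"

end

theory Submission imports Defs begin

text \<open>
  Cutting the lattice \<open>[0, \<infinity>]\<close> at a finite level \<open>t\<close>, that is, mapping \<open>x\<close> to the truth value of
  \<open>t < x\<close>, is a lattice homomorphism onto the two-element lattice.  It therefore turns
  \<^term>\<open>wlp w\<close> into a Boolean function of the cut arguments, and because \<open>w\<close> is monotone only the
  largest admissible set \<open>A\<close> matters in the outer join, namely the set \<open>B\<close> of arguments that
  exceed \<open>t\<close>: the system survives \<open>t\<close> iff \<open>t < w B\<close> (\<open>less_wlp_iff\<close>).  On the other side,
  \<^term>\<open>phi v\<close> takes the value \<^term>\<open>v B\<close> at the characteristic vector of \<open>B\<close> (\<open>phi_indicator\<close>),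
  since all summands except the one of \<open>B\<close> contain a vanishing factor.  Together these say that
  the system state at time \<open>t\<close> is given by \<^term>\<open>phi (level w t)\<close>.  Since every Boolean vector is
  characteristic, the properties of \<^term>\<open>phi (level w t)\<close> are those of the cut of \<open>w\<close>: it is
  monotone because \<open>w\<close> is, and by monotonicity it is constant iff its values at the smallest and
  the largest set agree.

  For uniqueness, the deterministic system in which the components of \<open>B\<close> never fail and all
  others fail at time \<open>0\<close> has the characteristic vector of \<open>B\<close> as its state at all times.  As the
  sample space is nonempty, this forces the value of any admissible family at that vector, and
  \<open>B\<close> is arbitrary.
\<close>

lemma less_INF_iff_finite:
  fixes x :: "'i \<Rightarrow> 'b::complete_linorder"
  assumes "finite A" "t < top"
  shows "t < (INF i\<in>A. x i) \<longleftrightarrow> (\<forall>i\<in>A. t < x i)"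
  using assms by induction (auto simp: complete_linorder_inf_min)

text \<open>
  A set \<open>A\<close> contributes a value above \<open>t\<close> to the join only if all its arguments exceed \<open>t\<close>.
  Monotonicity lets all such sets be replaced by their union.  The bound \<^term>\<open>t < top\<close> is what
  makes the empty meet exceed \<open>t\<close>.
\<close>

lemma less_wlp_iff:
  fixes w :: "'n::finite set \<Rightarrow> ennreal"
  assumes "mono w" "t < top"
  shows "t < wlp w x \<longleftrightarrow> t < w {i. t < x i}"
proof -
  have "t < wlp w x \<longleftrightarrow> (\<exists>A. t < w A \<and> (\<forall>i\<in>A. t < x i))"
    using assms(2) by (simp add: wlp_def less_SUP_iff less_INF_iff_finite
        complete_linorder_inf_min)
  also have "\<dots> \<longleftrightarrow> t < w {i. t < x i}"
  proof
    assume "\<exists>A. t < w A \<and> (\<forall>i\<in>A. t < x i)"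
    then obtain A where "t < w A" "A \<subseteq> {i. t < x i}"
      by auto
    then show "t < w {i. t < x i}"
      using monoD[OF assms(1)] by (meson less_le_trans)
  qed auto
  finally show ?thesis .
qed

lemma indicator_in_boolean_vectors: "indicator B \<in> boolean_vectors"
  by (auto simp: boolean_vectors_def indicator_def)

lemma boolean_vector_eq_indicator:
  assumes "x \<in> boolean_vectors"
  shows "x = indicator {i. x i = 1}"
proof
  fix i
  have "x i \<in> {0, 1}"
    using assms by (auto simp: boolean_vectors_def)
  then show "x i = indicator {i. x i = 1} i"
    by (auto simp: indicator_def)
qed

lemma phi_indicator:
  fixes v :: "'n::finite set \<Rightarrow> real"
  shows "phi v (indicator B) = v B"
proof -
  \<comment> \<open>The product belonging to a set \<open>A\<close> selects the characteristic vector of \<open>A\<close>.\<close>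
  have "(\<Prod>i\<in>A. indicator B i) * (\<Prod>i\<in>UNIV - A. 1 - indicator B i) = (of_bool (A = B) :: real)"
    for A
  proof (cases "A = B")
    case True
    then show ?thesis
      by simp
  next
    case False
    then consider i where "i \<in> A" "i \<notin> B" | i where "i \<in> B" "i \<notin> A"
      by blast
    then show ?thesis
    proof cases
      case 1
      then have "(\<Prod>i\<in>A. indicator B i) = (0 :: real)"
        by (intro prod_zero) (auto simp: indicator_def)
      with False show ?thesis
        by simp
    next
      case 2
      then have "(\<Prod>i\<in>UNIV - A. 1 - indicator B i) = (0 :: real)"
        by (intro prod_zero) (auto simp: indicator_def)
      with False show ?thesis
        by simp
    qed
  qed
  then have "phi v (indicator B) = (\<Sum>A\<in>UNIV. v A * of_bool (A = B))"
    unfolding phi_def by (simp only: indicator_in_boolean_vectors restrict_apply' mult.assoc)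
  also have "\<dots> = v B"
    by (simp add: of_bool_def if_distrib cong: if_cong)
  finally show ?thesis .
qed

lemma structure_function_eqI:
  assumes "f \<in> structure_functions" "g \<in> structure_functions"
    and "\<And>B. f (indicator B) = g (indicator B)"
  shows "f = g"
proof (rule PiE_ext)
  show "f \<in> boolean_vectors \<rightarrow>\<^sub>E {0, 1}" "g \<in> boolean_vectors \<rightarrow>\<^sub>E {0, 1}"
    using assms(1,2) by (auto simp: structure_functions_def)
  show "f x = g x" if "x \<in> boolean_vectors" for x
    using assms(3) boolean_vector_eq_indicator[OF that] by metis
qed

lemma phi_in_structure_functions:
  assumes "\<And>A. v A \<in> {0, 1}"
  shows "phi v \<in> structure_functions"
  unfolding structure_functions_def
proof (rule PiE_I)
  show "phi v x \<in> {0, 1}" if "x \<in> boolean_vectors" for x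
    using boolean_vector_eq_indicator[OF that] phi_indicator assms by metis
qed (simp add: phi_def)

lemma mono_on_phi:
  assumes "mono v"
  shows "mono_on boolean_vectors (phi v)"
proof (rule mono_onI)
  fix x y :: "'a \<Rightarrow> real"
  assume x: "x \<in> boolean_vectors" and y: "y \<in> boolean_vectors" and "x \<le> y"
  have "{i. x i = 1} \<subseteq> {i. y i = 1}"
  proof clarify
    fix i
    assume "x i = 1"
    moreover have "x i \<le> y i"
      using \<open>x \<le> y\<close> by (rule le_funD)
    moreover have "y i \<in> {0, 1}"
      using y by (auto simp: boolean_vectors_def)
    ultimately show "y i = 1"
      by auto
  qed
  then have "v {i. x i = 1} \<le> v {i. y i = 1}"
    by (rule monoD[OF assms])
  then show "phi v x \<le> phi v y"
    using boolean_vector_eq_indicator[OF x] boolean_vector_eq_indicator[OF y] phi_indicator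
    by metis
qed

lemma phi_constant_on_iff:
  assumes "mono v"
  shows "phi v constant_on boolean_vectors \<longleftrightarrow> v {} = v UNIV"
proof
  assume "phi v constant_on boolean_vectors"
  then have "phi v (indicator {}) = phi v (indicator UNIV)"
    unfolding constant_on_def using indicator_in_boolean_vectors by metis
  then show "v {} = v UNIV"
    unfolding phi_indicator .
next
  assume ends: "v {} = v UNIV"
  have "v A = v {}" for A
    using monoD[OF assms, of "{}" A] monoD[OF assms, of A UNIV] ends by simp
  then have "phi v x = v {}" if "x \<in> boolean_vectors" for x
    using boolean_vector_eq_indicator[OF that] phi_indicator by metis
  then show "phi v constant_on boolean_vectors"
    by (auto simp: constant_on_def)
qed

lemma mono_level:
  assumes "mono w"
  shows "mono (level w t)"
proof (rule monoI)
  fix A B :: "'a set"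
  assume "A \<subseteq> B"
  then have "w A \<le> w B"
    by (rule monoD[OF assms])
  then show "level w t A \<le> level w t B"
    by (auto simp: level_def)
qed

lemma states_eq_indicator: "(\<lambda>i. state (T i) t \<omega>) = indicator {i. ennreal t < T i \<omega>}"
  by (auto simp: state_def indicator_def)

lemma expresses_state_phi_level:
  assumes "mono w" "lifetime_system M (wlp w) T T\<^sub>S"
  shows "expresses_state M T T\<^sub>S (\<lambda>t. phi (level w t))"
  unfolding expresses_state_def
proof (intro allI impI ballI)
  fix t :: real and \<omega>
  assume "\<omega> \<in> space M"
  then have "T\<^sub>S \<omega> = wlp w (\<lambda>i. T i \<omega>)"
    using assms(2) by (simp add: lifetime_system_def)
  then show "state T\<^sub>S t \<omega> = phi (level w t) (\<lambda>i. state (T i) t \<omega>)"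
    unfolding states_eq_indicator phi_indicator
    by (simp add: state_def level_def less_wlp_iff[OF assms(1)])
qed

text \<open>
  The constant lifetimes \<open>\<infinity>\<close> on \<open>B\<close> and \<open>0\<close> elsewhere keep the components in the state
  \<^term>\<open>indicator B\<close> at all times, so every Boolean vector is realised at every time.
\<close>

lemma expressing_families_agree:
  fixes p :: "('n::finite \<Rightarrow> ennreal) \<Rightarrow> ennreal"
  assumes "space M \<noteq> {}"
    and \<psi>: "\<And>T T\<^sub>S. lifetime_system M p T T\<^sub>S \<Longrightarrow> expresses_state M T T\<^sub>S \<psi>"
    and \<theta>: "\<And>T T\<^sub>S. lifetime_system M p T T\<^sub>S \<Longrightarrow> expresses_state M T T\<^sub>S \<theta>"
    and "t \<ge> 0"
  shows "\<psi> t (indicator B) = \<theta> t (indicator B)"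
proof -
  obtain \<omega> where \<omega>: "\<omega> \<in> space M"
    using assms(1) by blast
  define T :: "'n \<Rightarrow> 'a \<Rightarrow> ennreal" where "T = (\<lambda>i _. if i \<in> B then top else 0)"
  define T\<^sub>S :: "'a \<Rightarrow> ennreal" where "T\<^sub>S = (\<lambda>_. p (\<lambda>i. if i \<in> B then top else 0))"
  have sys: "lifetime_system M p T T\<^sub>S"
    by (simp add: lifetime_system_def T\<^sub>S_def T_def)
  have states: "(\<lambda>i. state (T i) t \<omega>) = indicator B"
    unfolding states_eq_indicator by (simp add: T_def)
  have "state T\<^sub>S t \<omega> = \<psi> t (indicator B)" "state T\<^sub>S t \<omega> = \<theta> t (indicator B)"
    using \<psi>[OF sys] \<theta>[OF sys] \<omega> \<open>t \<ge> 0\<close>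
    unfolding expresses_state_def states[symmetric] by blast+
  then show ?thesis
    by simp
qed

theorem theorem8:
  fixes M :: "'a measure"
    and p :: "('n::finite \<Rightarrow> ennreal) \<Rightarrow> ennreal"
    and w :: "'n set \<Rightarrow> ennreal"
    and T :: "'n \<Rightarrow> 'a \<Rightarrow> ennreal"
    and T\<^sub>S :: "'a \<Rightarrow> ennreal"
  assumes "prob_space M"
    and "p \<in> weighted_lattice_polynomials"
    and "mono w"
    and "p = wlp w"
    and "lifetime_system M p T T\<^sub>S"
  shows "(\<forall>t\<ge>0. phi (level w t) \<in> structure_functions \<and>
              mono_on boolean_vectors (phi (level w t)) \<and>
              (\<not> phi (level w t) constant_on boolean_vectors \<longleftrightarrow>
                 w {} \<le> ennreal t \<and> ennreal t < w UNIV)) \<and>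
         expresses_state M T T\<^sub>S (\<lambda>t. phi (level w t)) \<and>
         (\<forall>\<psi>. (\<forall>t\<ge>0. \<psi> t \<in> structure_functions) \<and>
              (\<forall>T' T\<^sub>S'. lifetime_system M p T' T\<^sub>S' \<longrightarrow> expresses_state M T' T\<^sub>S' \<psi>) \<longrightarrow>
              (\<forall>t\<ge>0. \<psi> t = phi (level w t)))"
proof (intro conjI allI impI)
  fix t :: real
  show "phi (level w t) \<in> structure_functions"
    by (rule phi_in_structure_functions) (simp add: level_def)
  show "mono_on boolean_vectors (phi (level w t))"
    using \<open>mono w\<close> by (intro mono_on_phi mono_level)
  have "w {} \<le> w UNIV"
    using \<open>mono w\<close> by (simp add: monoD)
  then show "\<not> phi (level w t) constant_on boolean_vectors \<longleftrightarrow>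
      w {} \<le> ennreal t \<and> ennreal t < w UNIV"
    by (auto simp: phi_constant_on_iff[OF mono_level[OF \<open>mono w\<close>]] level_def)
next
  show "expresses_state M T T\<^sub>S (\<lambda>t. phi (level w t))"
    using \<open>mono w\<close> \<open>p = wlp w\<close> \<open>lifetime_system M p T T\<^sub>S\<close> by (simp add: expresses_state_phi_level)
next
  fix \<psi> and t :: real
  assume \<psi>: "(\<forall>t\<ge>0. \<psi> t \<in> structure_functions) \<and>
      (\<forall>T' T\<^sub>S'. lifetime_system M p T' T\<^sub>S' \<longrightarrow> expresses_state M T' T\<^sub>S' \<psi>)"
    and "t \<ge> 0"
  show "\<psi> t = phi (level w t)"
  proof (rule structure_function_eqI)
    show "\<psi> t \<in> structure_functions"
      using \<psi> \<open>t \<ge> 0\<close> by blast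
    show "phi (level w t) \<in> structure_functions"
      by (rule phi_in_structure_functions) (simp add: level_def)
    show "\<psi> t (indicator B) = phi (level w t) (indicator B)" for B
    proof (rule expressing_families_agree[where \<theta> = "\<lambda>t. phi (level w t)"])
      show "space M \<noteq> {}"
        using \<open>prob_space M\<close> by (rule prob_space.not_empty)
    qed (use \<psi> \<open>t \<ge> 0\<close> \<open>mono w\<close> \<open>p = wlp w\<close> expresses_state_phi_level in auto)
  qed
qed

end
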